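(* Let $G$ be a graph and let $\pi=(V_1,V_2,V_3,V_4)$ be an $\mathcal{MGP}$-partition of $G$. Then $\sigma(\pi)=V_1\cup V_1'\cup V_2'\cup V_3$ is a general position set of $\mathcal{M}(G)$.
   Context: All graphs are simple, connected and finite. $d_G$ is the graph distance. A set $S$ of vertices of a graph $H$ is a general position set if no shortest path in $H$ contains three or more vertices of $S$. The Mycielskian $\mathcal{M}(G)$ of a graph $G$ with vertex set $V$ and edge set $E$ has vertex set $V\cup V'\cup\{u^*\}$, where $V'=\{u' : u\in V\}$ is a disjoint copy of $V$ and $u^*$ is an additional vertex (the root), and edge set $E\cup\{uv' : uv\in E\}\cup\{v'u^* : v'\in V'\}$ (for each edge $uv\in E$ both $uv'$ and $vu'$ are included). For $X\subseteq V(G)$, $X'=\{x' : x\in X\}$. A partition $\pi=(V_1,V_2,V_3,V_4)$ of $V(G)$ into four (possibly empty) sets is an $\mathcal{MGP}$-partition if and only if: (1) if $e$ is an edge in the subgraph induced by $V_1\cup V_3$, then $e$ has both endpoints in $V_3$; (2) if a vertex $u\in V_1\cup V_3$ has a neighbour $v\in V_2$, then $d_G(u,w)=2$ for all $w\in (V_1\cup V_2)\setminus\{u,v\}$ and $d_G(u,w)\leq 3$ for all $w\in V_3\setminus\{u\}$; (3) if $P$ is a shortest path $u_0,u_1,\dots,u_\ell$ of length $\ell\leq 4$ in $G$ with both endpoints in $V_1\cup V_2\cup V_3$ that passes through three or more vertices of $V_1\cup V_2\cup V_3$, then either $u_0,u_\ell\in V_2$ and $\ell\geq 3$, or else $P$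 or its reverse has one of the forms: (a) $u_0,u_1,u_2$ where $u_0,u_1\in V_2$; (b) $u_0,u_1,u_2,u_3$ where $u_0,u_1\in V_2$, $u_2\notin V_1\cup V_2\cup V_3$ and $u_3\in V_1\cup V_3$; (c) $u_0,u_1,u_2,u_3,u_4$ where $u_0\in V_2$, $u_3\notin V_1\cup V_2$ and $u_4\in V_1\cup V_3$. *)

theory Defs
  imports "Graph_Theory.Graph_Theory"
begin

text \<open>
  A finite simple graph is a \<^locale>\<open>pair_graph\<close>: finitely many vertices and a symmetric,
  irreflexive set of arcs, an edge \<open>uv\<close> being the two arcs \<open>(u, v)\<close> and \<open>(v, u)\<close>.
\<close>

definition gdist :: "'a pair_pre_digraph \<Rightarrow> 'a \<Rightarrow> 'a \<Rightarrow> ereal" where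
  "gdist G u v = wf_digraph.\<mu> (with_proj G) (\<lambda>_. 1) u v"

definition shortest_path :: "'a pair_pre_digraph \<Rightarrow> 'a list \<Rightarrow> bool" where
  "shortest_path G p \<longleftrightarrow>
     vpath p (with_proj G) \<and> ereal (real (vwalk_length p)) = gdist G (hd p) (last p)"

definition general_position_set :: "'a pair_pre_digraph \<Rightarrow> 'a set \<Rightarrow> bool" where
  "general_position_set G S \<longleftrightarrow>
     S \<subseteq> pverts G \<and> \<not> (\<exists>p. shortest_path G p \<and> card (set p \<inter> S) \<ge> 3)"

text \<open>\<open>Copy u\<close> is the twin \<open>u'\<close> of \<open>u\<close>, and \<open>Root\<close> is the vertex \<open>u\<^sup>*\<close>.\<close>

datatype 'a mvertex = Orig 'a | Copy 'a | Root

definition mycielskian :: "'a pair_pre_digraph \<Rightarrow> 'a mvertex pair_pre_digraph" where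
  "mycielskian G = \<lparr>
     pverts = Orig ` pverts G \<union> Copy ` pverts G \<union> {Root},
     parcs = {(Orig u, Orig v) | u v. (u, v) \<in> parcs G}
       \<union> {(Orig u, Copy v) | u v. (u, v) \<in> parcs G}
       \<union> {(Copy v, Orig u) | u v. (u, v) \<in> parcs G}
       \<union> {(Copy v, Root) | v. v \<in> pverts G}
       \<union> {(Root, Copy v) | v. v \<in> pverts G} \<rparr>"

lemma pair_graph_mycielskian:
  assumes "pair_graph G"
  shows "pair_graph (mycielskian G)"
proof -
  interpret pair_graph G by (rule assms)
  have fv: "finite (pverts (mycielskian G))"
    by (simp add: mycielskian_def pair_finite_verts)
  have sub: "parcs (mycielskian G) \<subseteq> pverts (mycielskian G) \<times> pverts (mycielskian G)"
    by (auto simp: mycielskian_def dest: in_arcsD1 in_arcsD2)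
  then have fa: "finite (parcs (mycielskian G))"
    using fv by (meson finite_SigmaI finite_subset)
  have sy: "symmetric (with_proj (mycielskian G))"
    by (auto simp: symmetric_def sym_def mycielskian_def dest: arcs_symmetric)
  have lf: "fst e \<noteq> snd e" if "e \<in> parcs (mycielskian G)" for e
    using that by (auto simp: mycielskian_def dest: no_loops')
  show ?thesis
    by unfold_locales (use fv fa sy sub lf in auto)
qed

definition four_partition ::
  "'b set \<Rightarrow> 'b set \<Rightarrow> 'b set \<Rightarrow> 'b set \<Rightarrow> 'b set \<Rightarrow> bool" where
  "four_partition V V1 V2 V3 V4 \<longleftrightarrow>
     V1 \<union> V2 \<union> V3 \<union> V4 = V \<and>
     V1 \<inter> V2 = {} \<and> V1 \<inter> V3 = {} \<and> V1 \<inter> V4 = {} \<and>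
     V2 \<inter> V3 = {} \<and> V2 \<inter> V4 = {} \<and> V3 \<inter> V4 = {}"

definition mgp_form :: "'a set \<Rightarrow> 'a set \<Rightarrow> 'a set \<Rightarrow> 'a list \<Rightarrow> bool" where
  "mgp_form V1 V2 V3 p \<longleftrightarrow>
     (\<exists>u0 u1 u2. p = [u0, u1, u2] \<and> u0 \<in> V2 \<and> u1 \<in> V2) \<or>
     (\<exists>u0 u1 u2 u3. p = [u0, u1, u2, u3] \<and>
        u0 \<in> V2 \<and> u1 \<in> V2 \<and> u2 \<notin> V1 \<union> V2 \<union> V3 \<and> u3 \<in> V1 \<union> V3) \<or>
     (\<exists>u0 u1 u2 u3 u4. p = [u0, u1, u2, u3, u4] \<and>
        u0 \<in> V2 \<and> u3 \<notin> V1 \<union> V2 \<and> u4 \<in> V1 \<union> V3)"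

definition mgp_partition ::
  "'a pair_pre_digraph \<Rightarrow> 'a set \<Rightarrow> 'a set \<Rightarrow> 'a set \<Rightarrow> 'a set \<Rightarrow> bool" where
  "mgp_partition G V1 V2 V3 V4 \<longleftrightarrow>
     four_partition (pverts G) V1 V2 V3 V4 \<and>
     (\<forall>e \<in> arcs (with_proj G \<restriction> (V1 \<union> V3)). fst e \<in> V3 \<and> snd e \<in> V3) \<and>
     (\<forall>u \<in> V1 \<union> V3. \<forall>v \<in> V2. (u, v) \<in> parcs G \<longrightarrow>
        (\<forall>w \<in> (V1 \<union> V2) - {u, v}. gdist G u w = 2) \<and>
        (\<forall>w \<in> V3 - {u}. gdist G u w \<le> 3)) \<and>
     (\<forall>p. shortest_path G p \<and> vwalk_length p \<le> 4 \<and>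
          hd p \<in> V1 \<union> V2 \<union> V3 \<and> last p \<in> V1 \<union> V2 \<union> V3 \<and>
          card (set p \<inter> (V1 \<union> V2 \<union> V3)) \<ge> 3 \<longrightarrow>
        (hd p \<in> V2 \<and> last p \<in> V2 \<and> vwalk_length p \<ge> 3) \<or>
        mgp_form V1 V2 V3 p \<or> mgp_form V1 V2 V3 (rev p))"

definition mgp_sigma :: "'a set \<Rightarrow> 'a set \<Rightarrow> 'a set \<Rightarrow> 'a set \<Rightarrow> 'a mvertex set" where
  "mgp_sigma V1 V2 V3 V4 = Orig ` V1 \<union> Copy ` V1 \<union> Copy ` V2 \<union> Orig ` V3"

end

theory Submission
  imports Defs
begin

text \<open>
  Everything reduces to arithmetic with distances. A shortest path with three vertices of \<open>S\<close>
  exists only if there are distinct \<open>a, b, c \<in> S\<close> with \<open>d(a, b) + d(b, c) = d(a, c)\<close>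
  (\<open>general_position_setI\<close>), and conversely an additive triple in \<open>G\<close> lies on a shortest path, to
  which the third condition on the partition applies.

  Distances in the Mycielskian are those of \<open>G\<close>, truncated because a detour through the root
  is short: \<open>d(u, v) = min d\<^sub>G(u, v) 4\<close> and, for \<open>u \<noteq> v\<close>, \<open>d(u, v') = min d\<^sub>G(u, v) 3\<close>
  and \<open>d(u', v') = 2\<close>; twins \<open>u, u'\<close> are at distance 2. The upper bounds are explicit walks.
  The lower bounds come from the function \<open>level u\<close>, which takes the claimed values and grows by
  at most one along every edge.

  In all the exceptional paths that the third condition allows, at least one end lies in \<open>V\<^sub>2\<close>,
  and an original vertex in \<open>\<sigma>(\<pi>)\<close> never comes from \<open>V\<^sub>2\<close>. Hence a geodesic of \<open>G\<close>
  with length at most 4, three marked vertices (those in \<open>V\<^sub>1 \<union> V\<^sub>2 \<union> V\<^sub>3\<close>)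
  and one end in \<open>V\<^sub>1 \<union> V\<^sub>3\<close> has its other end in \<open>V\<^sub>2\<close>, and up to length 3 its marked inner vertices are in \<open>V\<^sub>2\<close> as well
  (\<open>geodesic_to_V1_V3\<close>). This excludes every additive triple of \<open>\<sigma>(\<pi>)\<close> whose distances
  are those between the underlying vertices of \<open>G\<close>. Any other additive triple contains an
  original \<open>u\<close> adjacent in \<open>G\<close> to the base \<open>v\<close> of a copy in the triple. Then the first
  condition excludes \<open>v \<in> V\<^sub>1\<close>, so that \<open>v \<in> V\<^sub>2\<close>, and the second condition
  restricts the distances from \<open>u\<close> so tightly that additivity fails.
\<close>

section \<open>Step distance of a relation\<close>

text \<open>
  This is the graph distance when applied to the arc set of a graph and two vertices joined by a
  walk. It takes values in \<open>nat\<close>, which keeps the case distinctions below in linear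
  arithmetic; for unrelated points the value is arbitrary.
\<close>

definition hops :: "('b \<times> 'b) set \<Rightarrow> 'b \<Rightarrow> 'b \<Rightarrow> nat" where
  "hops R u v = (LEAST n. (u, v) \<in> R ^^ n)"

lemma hops_le: "(u, v) \<in> R ^^ n \<Longrightarrow> hops R u v \<le> n"
  unfolding hops_def by (rule Least_le)

lemma relpow_hops: "(u, v) \<in> R ^^ n \<Longrightarrow> (u, v) \<in> R ^^ hops R u v"
  unfolding hops_def by (rule LeastI)

lemma hops_self [simp]: "hops R u u = 0"
  using hops_le[where n = 0 and R = R and u = u and v = u] by simp

lemma relpow_2I: "(x, y) \<in> R \<Longrightarrow> (y, z) \<in> R \<Longrightarrow> (x, z) \<in> R ^^ 2"
  by (auto simp: numeral_2_eq_2)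

lemma hops_triangle:
  assumes "(x, y) \<in> R ^^ m" "(y, z) \<in> R ^^ n"
  shows "hops R x z \<le> hops R x y + hops R y z"
proof (rule hops_le)
  show "(x, z) \<in> R ^^ (hops R x y + hops R y z)"
    using relpow_hops[OF assms(1)] relpow_hops[OF assms(2)] by (auto simp: relpow_add)
qed

lemma hops_commute:
  assumes "sym R"
  shows "hops R u v = hops R v u"
proof -
  have "(x, y) \<in> R ^^ n \<Longrightarrow> (y, x) \<in> R ^^ n" for x y n
  proof (induction n arbitrary: y)
    case (Suc n)
    then obtain w where "(x, w) \<in> R ^^ n" "(w, y) \<in> R" by auto
    with Suc.IH assms show ?case by (meson relpow_Suc_I2 symD)
  qed simp
  then have "(\<lambda>n. (u, v) \<in> R ^^ n) = (\<lambda>n. (v, u) \<in> R ^^ n)" by blast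
  then show ?thesis unfolding hops_def by simp
qed

text \<open>
  A function that grows by at most one along each step bounds walk lengths from below. For the
  Mycielskian this replaces projecting its walks back to the graph.
\<close>

lemma potential_le_relpow:
  fixes f :: "'b \<Rightarrow> nat"
  assumes "\<And>x y. (x, y) \<in> R \<Longrightarrow> f y \<le> Suc (f x)" and "(u, v) \<in> R ^^ n"
  shows "f v \<le> f u + n"
  using assms(2)
proof (induction n arbitrary: v)
  case (Suc n)
  then obtain w where "(u, w) \<in> R ^^ n" "(w, v) \<in> R" by auto
  with Suc.IH[of w] assms(1)[of w v] show ?case by simp
qed simp

section \<open>Shortest paths in terms of the step distance\<close>

context pair_wf_digraph
begin

lemma relpow_if_awalk: "awalk u p v \<Longrightarrow> (u, v) \<in> parcs G ^^ length p"
proof (induction p arbitrary: u)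
  case (Cons e p)
  then show ?case by (cases e) (auto simp: awalk_Cons_iff simp del: relpow.simps intro: relpow_Suc_I2)
qed (simp add: awalk_Nil_iff)

lemma awalk_if_relpow:
  "(u, v) \<in> parcs G ^^ n \<Longrightarrow> u \<in> pverts G \<Longrightarrow> \<exists>p. awalk u p v \<and> length p = n"
proof (induction n arbitrary: u)
  case 0
  then show ?case by (auto simp: awalk_Nil_iff)
next
  case (Suc n)
  from Suc.prems obtain w where w: "(u, w) \<in> parcs G" "(w, v) \<in> parcs G ^^ n"
    by (meson relpow_Suc_D2)
  with Suc.IH[OF w(2)] obtain p where "awalk w p v" "length p = n"
    by (auto dest: in_arcsD2)
  with w(1) have "awalk u ((u, w) # p) v \<and> length ((u, w) # p) = Suc n"
    by (simp add: awalk_Cons_iff)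
  then show ?case by blast
qed

lemma gdist_eq_hops:
  assumes "u \<in> pverts G" "(u, v) \<in> parcs G ^^ n"
  shows "gdist G u v = ereal (real (hops (parcs G) u v))"
proof -
  have cost: "awalk_cost (\<lambda>_. 1) p = real (length p)" for p
    by (induction p) auto
  obtain p where p: "awalk u p v" "length p = hops (parcs G) u v"
    using awalk_if_relpow[OF relpow_hops[OF assms(2)] assms(1)] by blast
  show ?thesis
    unfolding gdist_def \<mu>_def
  proof (rule antisym)
    show "(INF p\<in>{p. awalk u p v}. ereal (awalk_cost (\<lambda>_. 1) p)) \<le> ereal (real (hops (parcs G) u v))"
      using p by (intro INF_lower2[of p]) (auto simp: cost)
    show "ereal (real (hops (parcs G) u v)) \<le> (INF p\<in>{p. awalk u p v}. ereal (awalk_cost (\<lambda>_. 1) p))"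
      by (intro INF_greatest) (auto simp: cost intro: hops_le relpow_if_awalk)
  qed
qed

lemma set_vwalk_arcs: "set (vwalk_arcs p) = {(p ! i, p ! Suc i) |i. Suc i < length p}"
proof (induction p rule: vwalk_arcs.induct)
  case (3 x y xs)
  have "{((x # y # xs) ! i, (x # y # xs) ! Suc i) |i. Suc i < length (x # y # xs)}
      = insert (x, y) {((y # xs) ! i, (y # xs) ! Suc i) |i. Suc i < length (y # xs)}"
    (is "?L = ?R")
  proof
    show "?L \<subseteq> ?R"
    proof
      fix a assume "a \<in> ?L"
      then obtain i where "a = ((x # y # xs) ! i, (x # y # xs) ! Suc i)"
        "Suc i < length (x # y # xs)" by blast
      then show "a \<in> ?R" by (cases i) auto
    qed
    show "?R \<subseteq> ?L" by (force intro: exI[of _ "Suc _"])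
  qed
  with 3 show ?case by simp
qed auto

text \<open>
  A shortest path is isometric: by the triangle inequality, a shortcut between two of its vertices
  would shorten the whole path.
\<close>

lemma hops_on_shortest_path:
  assumes "shortest_path G p" "i \<le> j" "j < length p"
  shows "hops (parcs G) (p ! i) (p ! j) = j - i"
proof -
  let ?E = "parcs G"
  have p: "set p \<subseteq> pverts G" "p \<noteq> []" and arcs: "set (vwalk_arcs p) \<subseteq> ?E"
    using assms(1) by (auto simp: shortest_path_def vpath_def vwalk_def)
  have sub: "(p ! k, p ! l) \<in> ?E ^^ (l - k)" if "k \<le> l" "l < length p" for k l
    using that
  proof (induction l rule: dec_induct)
    case (step n)
    then have "(p ! n, p ! Suc n) \<in> ?E" using arcs by (auto simp: set_vwalk_arcs)
    with step show ?case by (auto simp: Suc_diff_le)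
  qed simp
  let ?n = "length p - 1"
  have ends: "hd p = p ! 0" "last p = p ! ?n"
    using p(2) by (auto simp: hd_conv_nth last_conv_nth)
  have all: "(p ! 0, p ! ?n) \<in> ?E ^^ ?n" using sub[of 0 ?n] p(2) by simp
  have "p ! 0 \<in> pverts G" using p by (auto simp: nth_mem subset_iff)
  with gdist_eq_hops[OF this all] assms(1) have total: "hops ?E (p ! 0) (p ! ?n) = ?n"
    by (simp add: shortest_path_def ends)
  have s: "(p ! 0, p ! i) \<in> ?E ^^ (i - 0)" "(p ! i, p ! j) \<in> ?E ^^ (j - i)"
    "(p ! j, p ! ?n) \<in> ?E ^^ (?n - j)"
    using assms(2,3) by (intro sub; simp)+
  have sij: "(p ! 0, p ! j) \<in> ?E ^^ (j - 0)" using assms by (intro sub) auto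
  have "?n \<le> hops ?E (p ! 0) (p ! i) + hops ?E (p ! i) (p ! j) + hops ?E (p ! j) (p ! ?n)"
    using hops_triangle[OF sij s(3)] hops_triangle[OF s(1,2)] total by linarith
  with s[THEN hops_le] assms(2,3) show ?thesis by linarith
qed

text \<open>
  Concatenating walks from \<open>x\<close> to \<open>y\<close> and from \<open>y\<close> to \<open>z\<close> of total length
  \<open>d(x, z)\<close> gives a path, since a repeated vertex would allow cutting out a cycle. This turns
  an additive triple into the kind of object that the conditions on partitions speak about.
\<close>

lemma shortest_path_through:
  assumes x: "x \<in> pverts G"
    and xy: "(x, y) \<in> parcs G ^^ m" and yz: "(y, z) \<in> parcs G ^^ n"
    and geo: "hops (parcs G) x z = m + n"
  obtains p where "shortest_path G p" "length p = Suc (m + n)" "p ! 0 = x" "p ! m = y"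
    "p ! (m + n) = z"
proof -
  let ?E = "parcs G"
  obtain f where f: "f 0 = x" "f m = y" "\<forall>i<m. (f i, f (Suc i)) \<in> ?E"
    using xy by (auto simp: relpow_fun_conv)
  obtain g where g: "g 0 = y" "g n = z" "\<forall>i<n. (g i, g (Suc i)) \<in> ?E"
    using yz by (auto simp: relpow_fun_conv)
  define h where "h i = (if i \<le> m then f i else g (i - m))" for i
  have h: "h 0 = x" "h m = y" "h (m + n) = z" using f g by (auto simp: h_def)
  have adj: "(h i, h (Suc i)) \<in> ?E" if "i < m + n" for i
  proof (cases "i < m")
    case True
    then show ?thesis using f by (simp add: h_def)
  next
    case False
    then have "(g (i - m), g (Suc (i - m))) \<in> ?E" using g that by auto
    with False f g show ?thesis by (cases "i = m") (auto simp: h_def Suc_diff_le)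
  qed
  have vert: "h i \<in> pverts G" if "i \<le> m + n" for i
    using that x h(1) adj[of "i - 1"] by (cases i) (auto dest: in_arcsD2)
  have sub: "(h k, h l) \<in> ?E ^^ (l - k)" if "k \<le> l" "l \<le> m + n" for k l
    using that
  proof (induction l rule: dec_induct)
    case (step n)
    then show ?case using adj by (auto simp: Suc_diff_le)
  qed simp
  \<comment> \<open>A repetition could be cut out, giving a walk shorter than the distance.\<close>
  have ne: "h k \<noteq> h l" if "k < l" "l \<le> m + n" for k l
  proof
    assume eq: "h k = h l"
    have "(x, h k) \<in> ?E ^^ k" using sub[of 0 k] that h by simp
    moreover have "(h k, z) \<in> ?E ^^ (m + n - l)" using sub[of l "m + n"] that h eq by simp
    ultimately have "(x, z) \<in> ?E ^^ (k + (m + n - l))" by (auto simp: relpow_add)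
    from hops_le[OF this] geo that show False by simp
  qed
  define p where "p = map h [0..<Suc (m + n)]"
  have len: "length p = Suc (m + n)" by (simp add: p_def)
  have nth: "p ! i = h i" if "i \<le> m + n" for i
    using that unfolding p_def by (metis add_0 diff_zero le_imp_less_Suc length_upt nth_map nth_upt)
  have "p \<noteq> []" using len by auto
  then have ends: "hd p = x" "last p = z" using h nth len by (auto simp: hd_conv_nth last_conv_nth)
  have "distinct p"
    unfolding distinct_conv_nth using len nth ne by (metis less_Suc_eq_le nat_neq_iff)
  moreover have "set p \<subseteq> pverts G" using vert by (auto simp: p_def less_Suc_eq_le)
  moreover have "set (vwalk_arcs p) \<subseteq> ?E"
    using adj nth len by (auto simp: set_vwalk_arcs)
  ultimately have "vpath p (with_proj G)"
    using \<open>p \<noteq> []\<close> by (auto simp: vpath_def vwalk_def)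
  moreover have "(x, z) \<in> ?E ^^ (m + n)" using sub[of 0 "m + n"] h by simp
  ultimately have "shortest_path G p"
    using gdist_eq_hops[OF x, of z] geo len by (auto simp: shortest_path_def ends)
  with len nth h show ?thesis by (intro that) auto
qed

text \<open>
  Three vertices on a shortest path, taken in the order of the path, form an additive triple because
  the path is isometric.
\<close>

lemma general_position_setI:
  assumes "S \<subseteq> pverts G"
    and "\<And>a b c. \<lbrakk>a \<in> S; b \<in> S; c \<in> S; a \<noteq> b; b \<noteq> c; a \<noteq> c\<rbrakk> \<Longrightarrow>
      hops (parcs G) a b + hops (parcs G) b c \<noteq> hops (parcs G) a c"
  shows "general_position_set G S"
  unfolding general_position_set_def
proof (intro conjI notI)
  assume "\<exists>p. shortest_path G p \<and> 3 \<le> card (set p \<inter> S)"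
  then obtain p where p: "shortest_path G p" "3 \<le> card (set p \<inter> S)" by blast
  let ?I = "{i. i < length p \<and> p ! i \<in> S}"
  have "set p \<inter> S = (!) p ` ?I" by (auto simp: in_set_conv_nth)
  then have "3 \<le> card ?I" using p(2) card_image_le[of ?I "(!) p"] by simp
  then obtain T where "T \<subseteq> ?I" "card T = 3" by (meson obtain_subset_with_card_n)
  then have T: "finite T" "T \<subseteq> ?I" "card T = 3" by (auto intro: card_ge_0_finite)
  obtain ts :: "nat list" where "length ts = 3" "sorted_wrt (<) ts" "set ts \<subseteq> ?I"
    using T by (intro that[of "sorted_list_of_set T"]) auto
  then obtain i j k where I: "i \<in> ?I" "j \<in> ?I" "k \<in> ?I" "i < j" "j < k"
    by (auto simp: numeral_3_eq_3 length_Suc_conv)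
  have "distinct p" using p(1) by (simp add: shortest_path_def vpath_def)
  with I have "p ! i \<noteq> p ! j" "p ! j \<noteq> p ! k" "p ! i \<noteq> p ! k"
    by (auto simp: nth_eq_iff_index_eq)
  moreover have "hops (parcs G) (p ! i) (p ! j) + hops (parcs G) (p ! j) (p ! k)
      = hops (parcs G) (p ! i) (p ! k)"
    using I hops_on_shortest_path[OF p(1)] by simp
  ultimately show False using assms(2) I by blast
qed (rule assms(1))

end

section \<open>Distances in the Mycielskian\<close>

locale connected_pair_graph = pair_graph +
  assumes connected: "Digraph_Component.connected (with_proj G)"
begin

text \<open>\<open>D\<close> and \<open>DM\<close> are the distances in the graph and in its Mycielskian.\<close>

abbreviation D :: "'a \<Rightarrow> 'a \<Rightarrow> nat" where "D \<equiv> hops (parcs G)"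

abbreviation N :: "'a mvertex rel" where "N \<equiv> parcs (mycielskian G)"

abbreviation DM :: "'a mvertex \<Rightarrow> 'a mvertex \<Rightarrow> nat" where "DM \<equiv> hops N"

lemma sym_parcs: "sym (parcs G)"
  using pair_sym_arcs by (simp add: symmetric_def)

lemma D_commute: "D u v = D v u"
  by (rule hops_commute[OF sym_parcs])

lemma relpow_D:
  assumes "u \<in> pverts G" "v \<in> pverts G"
  shows "(u, v) \<in> parcs G ^^ D u v"
proof -
  have "strongly_connected (with_proj G)"
    using symmetric_connected_imp_strongly_connected pair_sym_arcs connected by blast
  with assms have "u \<rightarrow>\<^sup>*\<^bsub>with_proj G\<^esub> v" by (auto simp: strongly_connected_def)
  then obtain p where "awalk u p v" by (auto simp: reachable_awalk)
  then show ?thesis by (rule relpow_hops[OF relpow_if_awalk])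
qed

lemma D_pos:
  assumes "u \<in> pverts G" "v \<in> pverts G" "u \<noteq> v"
  shows "0 < D u v"
  using relpow_D[OF assms(1,2)] assms(3) by (cases "D u v") auto

lemma D_triangle:
  assumes "u \<in> pverts G" "v \<in> pverts G" "w \<in> pverts G"
  shows "D u w \<le> D u v + D v w"
  using hops_triangle[OF relpow_D[OF assms(1,2)] relpow_D[OF assms(2,3)]] .

lemma adjacent_if_D_eq_1:
  assumes "u \<in> pverts G" "v \<in> pverts G" "D u v = 1"
  shows "(u, v) \<in> parcs G"
  using relpow_D[OF assms(1,2)] assms(3) by simp

lemma D_adjacent:
  assumes "(u, v) \<in> parcs G"
  shows "D u v = 1"
proof -
  have "D u v \<le> 1" using assms by (intro hops_le) simp
  moreover have "0 < D u v" using assms by (intro D_pos) (auto dest: in_arcsD1 in_arcsD2 no_loops')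
  ultimately show ?thesis by simp
qed

lemma ex_neighbour:
  assumes "u \<in> pverts G" "v \<in> pverts G" "u \<noteq> v"
  obtains w where "(u, w) \<in> parcs G"
proof -
  obtain n where "D u v = Suc n" using D_pos[OF assms] gr0_implies_Suc by blast
  with relpow_D[OF assms(1,2)] have "(u, v) \<in> parcs G ^^ Suc n" by metis
  with that show ?thesis by (meson relpow_Suc_D2)
qed

lemma D_step:
  assumes "u \<in> pverts G" "(v, w) \<in> parcs G"
  shows "D u w \<le> Suc (D u v)"
proof -
  have "v \<in> pverts G" "w \<in> pverts G" using assms(2) by (auto dest: in_arcsD1 in_arcsD2)
  with D_triangle[OF assms(1), of v w] D_adjacent[OF assms(2)] show ?thesis by simp
qed

lemma N_simps [simp]:
  "(Orig u, Orig v) \<in> N \<longleftrightarrow> (u, v) \<in> parcs G"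
  "(Orig u, Copy v) \<in> N \<longleftrightarrow> (u, v) \<in> parcs G"
  "(Copy u, Orig v) \<in> N \<longleftrightarrow> (v, u) \<in> parcs G"
  "(Copy u, Root) \<in> N \<longleftrightarrow> u \<in> pverts G"
  "(Root, Copy u) \<in> N \<longleftrightarrow> u \<in> pverts G"
  "(Orig u, Root) \<notin> N" "(Root, Orig u) \<notin> N" "(Root, Root) \<notin> N" "(Copy u, Copy v) \<notin> N"
  by (auto simp: mycielskian_def)

lemma DM_commute: "DM a b = DM b a"
proof (rule hops_commute)
  interpret M: pair_graph "mycielskian G" by (rule pair_graph_mycielskian) unfold_locales
  show "sym N" using M.pair_sym_arcs by (simp add: symmetric_def)
qed

lemma DM_Copy_Orig: "DM (Copy v) (Orig u) = DM (Orig u) (Copy v)"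
  by (rule DM_commute)

text \<open>
  The distance from \<open>Orig u\<close> in the Mycielskian, provided that \<open>u\<close> has a neighbour. The twin
  is special: it is reached in two steps through a neighbour, whereas \<open>D u u = 0\<close>.
\<close>

definition level :: "'a \<Rightarrow> 'a mvertex \<Rightarrow> nat" where
  "level u a = (case a of
     Orig v \<Rightarrow> min (D u v) 4
   | Copy v \<Rightarrow> if v = u then 2 else min (D u v) 3
   | Root \<Rightarrow> 2)"

text \<open>
  Arcs between originals, or between an original and a copy, project to arcs of the graph, so
  \<open>D u\<close> changes by at most one. The values of \<open>level u\<close> at copies lie between 1 and 3, so the
  arcs at the root are harmless.
\<close>

lemma level_step:
  assumes "u \<in> pverts G" "(a, b) \<in> N"
  shows "level u b \<le> Suc (level u a)"
proof -
  have flip: "(w, v) \<in> parcs G" if "(v, w) \<in> parcs G" for v w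
    using that sym_parcs by (auto dest: symD)
  have near: "D u w \<le> Suc (D u v) \<and> D u v \<le> Suc (D u w)
      \<and> (v = u \<longrightarrow> D u w = 1) \<and> (w = u \<longrightarrow> D u v = 1)"
    if "(v, w) \<in> parcs G" for v w
    using D_step[OF assms(1)] that flip D_adjacent by blast
  have pos: "Suc 0 \<le> D u v" if "v \<in> pverts G" "v \<noteq> u" for v
    using D_pos[OF assms(1) that(1)] that(2) by simp
  show ?thesis
    using assms(2) pos
    by (cases a; cases b) (auto simp: level_def min_def not_le dest!: near)
qed

lemma level_le_relpow: "u \<in> pverts G \<Longrightarrow> (Orig u, b) \<in> N ^^ n \<Longrightarrow> level u b \<le> n"
  using potential_le_relpow[of N "level u" "Orig u" b n] level_step[of u]
  by (simp add: level_def)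

lemma relpow_Orig:
  "(u, v) \<in> parcs G ^^ n \<Longrightarrow> (Orig u, Orig v) \<in> N ^^ n"
  by (induction n arbitrary: v) (force intro: relpow_Suc_I)+

lemma relpow_Orig_Copy:
  assumes "(u, v) \<in> parcs G ^^ n" "0 < n"
  shows "(Orig u, Copy v) \<in> N ^^ n"
proof -
  obtain k where n: "n = Suc k" using assms(2) gr0_implies_Suc by blast
  with assms(1) obtain w where "(u, w) \<in> parcs G ^^ k" "(w, v) \<in> parcs G" by auto
  then show ?thesis unfolding n by (intro relpow_Suc_I[OF relpow_Orig]) auto
qed

text \<open>
  The lower bound always holds, so only a walk of the right length has to be exhibited.
\<close>

lemma DM_eqI:
  assumes "u \<in> pverts G" "(Orig u, b) \<in> N ^^ level u b"
  shows "DM (Orig u) b = level u b"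
  using hops_le[OF assms(2)] level_le_relpow[OF assms(1) relpow_hops[OF assms(2)]] by simp

lemma relpow_Orig_Root:
  assumes "u \<in> pverts G" "v \<in> pverts G" "u \<noteq> v"
  shows "(Orig u, Root) \<in> N ^^ 2"
proof -
  obtain w where "(u, w) \<in> parcs G" using ex_neighbour[OF assms] .
  then have "(Orig u, Copy w) \<in> N" "(Copy w, Root) \<in> N" by (auto dest: in_arcsD2)
  then show ?thesis by (rule relpow_2I)
qed

lemma DM_Orig_Orig:
  assumes "u \<in> pverts G" "v \<in> pverts G"
  shows "DM (Orig u) (Orig v) = min (D u v) 4"
proof (cases "D u v \<le> 4")
  case True
  then have "(Orig u, Orig v) \<in> N ^^ level u (Orig v)"
    using relpow_Orig[OF relpow_D[OF assms]] by (simp add: level_def)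
  from DM_eqI[OF assms(1) this] show ?thesis by (simp add: level_def)
next
  case False
  then have "u \<noteq> v" by auto
  then obtain w where w: "(v, w) \<in> parcs G" using ex_neighbour[OF assms(2,1)] by blast
  then have "(Root, Copy w) \<in> N" "(Copy w, Orig v) \<in> N" by (auto dest: in_arcsD2)
  with relpow_Orig_Root[OF assms \<open>u \<noteq> v\<close>] have "(Orig u, Orig v) \<in> N ^^ Suc (Suc 2)"
    by (meson relpow_Suc_I)
  then have "(Orig u, Orig v) \<in> N ^^ level u (Orig v)"
    using False by (simp add: level_def min_def numeral_eq_Suc)
  from DM_eqI[OF assms(1) this] show ?thesis by (simp add: level_def)
qed

lemma DM_Orig_Copy:
  assumes "u \<in> pverts G" "v \<in> pverts G" "u \<noteq> v"
  shows "DM (Orig u) (Copy v) = min (D u v) 3"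
proof -
  have "(Orig u, Copy v) \<in> N ^^ D u v"
    using relpow_Orig_Copy[OF relpow_D[OF assms(1,2)] D_pos[OF assms]] .
  moreover have "(Orig u, Copy v) \<in> N ^^ Suc 2"
    using relpow_Orig_Root[OF assms] assms(2) by (meson N_simps(5) relpow_Suc_I)
  ultimately have "(Orig u, Copy v) \<in> N ^^ level u (Copy v)"
    using assms(3) by (simp add: level_def min_def numeral_eq_Suc del: relpow.simps)
  from DM_eqI[OF assms(1) this] show ?thesis using assms(3) by (simp add: level_def)
qed

lemma DM_twins:
  assumes "u \<in> pverts G" "v \<in> pverts G" "u \<noteq> v"
  shows "DM (Orig u) (Copy u) = 2"
proof -
  obtain w where w: "(u, w) \<in> parcs G" using ex_neighbour[OF assms] .
  with sym_parcs have "(w, u) \<in> parcs G" by (auto dest: symD)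
  with w have "(u, u) \<in> parcs G ^^ 2" by (rule relpow_2I)
  from relpow_Orig_Copy[OF this] have "(Orig u, Copy u) \<in> N ^^ level u (Copy u)"
    by (simp add: level_def)
  from DM_eqI[OF assms(1) this] show ?thesis by (simp add: level_def)
qed

lemma DM_Copy_Copy:
  assumes "u \<in> pverts G" "v \<in> pverts G" "u \<noteq> v"
  shows "DM (Copy u) (Copy v) = 2"
proof -
  have "(Copy u, Copy v) \<in> N ^^ 2" using assms by (intro relpow_2I[of _ Root]) auto
  note le = hops_le[OF this] and mem = relpow_hops[OF this]
  have "DM (Copy u) (Copy v) \<noteq> 0" "DM (Copy u) (Copy v) \<noteq> 1"
    using mem assms(3) by (metis mvertex.inject(2) relpow_0_E, metis N_simps(9) relpow_1)
  with le show ?thesis by linarith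
qed

end

section \<open>Partitions\<close>

locale mgp_partitioned_graph = connected_pair_graph +
  fixes V1 V2 V3 V4 :: "'a set"
  assumes partition: "mgp_partition G V1 V2 V3 V4"
begin

lemma in_pverts: "x \<in> V1 \<union> V2 \<union> V3 \<Longrightarrow> x \<in> pverts G"
  using partition by (auto simp: mgp_partition_def four_partition_def)

lemma disjoint: "V2 \<inter> (V1 \<union> V3) = {}"
  using partition by (auto simp: mgp_partition_def four_partition_def)

text \<open>
  The first condition: a neighbour of \<open>V1 \<union> V3\<close> is never in \<open>V1\<close>. For the base of a copy in
  \<open>\<sigma>\<close>, this leaves only \<open>V2\<close>.
\<close>

lemma not_adjacent_V1:
  assumes "(x, y) \<in> parcs G" "x \<in> V1 \<union> V3"
  shows "y \<notin> V1"
proof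
  assume "y \<in> V1"
  with assms have "(x, y) \<in> arcs (with_proj G \<restriction> (V1 \<union> V3))" by simp
  moreover have "\<forall>e \<in> arcs (with_proj G \<restriction> (V1 \<union> V3)). fst e \<in> V3 \<and> snd e \<in> V3"
    using partition unfolding mgp_partition_def by blast
  ultimately have "y \<in> V3" by fastforce
  with \<open>y \<in> V1\<close> partition show False by (auto simp: mgp_partition_def four_partition_def)
qed

text \<open>
  The second condition, in terms of \<open>D\<close>.
\<close>

lemma D_neighbour_of_V2:
  assumes "u \<in> V1 \<union> V3" "v \<in> V2" "(u, v) \<in> parcs G"
  shows "w \<in> V1 \<union> V2 \<Longrightarrow> w \<noteq> u \<Longrightarrow> w \<noteq> v \<Longrightarrow> D u w = 2"
    and "w \<in> V3 \<Longrightarrow> w \<noteq> u \<Longrightarrow> D u w \<le> 3"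
proof -
  have g: "gdist G u w = ereal (real (D u w))" if "w \<in> V1 \<union> V2 \<union> V3" for w
    using gdist_eq_hops relpow_D in_pverts assms(1) that by blast
  have c: "\<forall>w \<in> (V1 \<union> V2) - {u, v}. gdist G u w = 2" "\<forall>w \<in> V3 - {u}. gdist G u w \<le> 3"
    using partition assms unfolding mgp_partition_def by blast+
  show "D u w = 2" if "w \<in> V1 \<union> V2" "w \<noteq> u" "w \<noteq> v"
  proof -
    have "gdist G u w = 2" using c(1) that by blast
    with g[OF UnI1[OF that(1)]] show ?thesis by simp
  qed
  show "D u w \<le> 3" if "w \<in> V3" "w \<noteq> u"
  proof -
    have "gdist G u w \<le> 3" using c(2) that by blast
    with g[of w] that(1) show ?thesis by simp
  qed
qed

text \<open>
  The third condition, in terms of \<open>D\<close>. As \<open>z \<notin> V2\<close>, all the exceptional paths with both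
  ends in \<open>V2\<close> and all the forms read backwards drop out. What remains are the forms (a), (b), (c),
  which start in \<open>V2\<close>; in (a) and (b), the only marked inner vertex is \<open>u1 \<in> V2\<close>.
\<close>

lemma geodesic_to_V1_V3:
  assumes x: "x \<in> V1 \<union> V2 \<union> V3" and y: "y \<in> V1 \<union> V2 \<union> V3" and z: "z \<in> V1 \<union> V3"
    and ne: "x \<noteq> y" "y \<noteq> z" "x \<noteq> z"
    and geo: "D x y + D y z = D x z" and short: "D x z \<le> 4"
  shows "x \<in> V2" and "D x z \<le> 3 \<Longrightarrow> y \<in> V2"
proof -
  let ?m = "D x y" and ?n = "D y z" and ?W = "V1 \<union> V2 \<union> V3"
  have verts: "x \<in> pverts G" "y \<in> pverts G" "z \<in> pverts G"
    using in_pverts x y z by auto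
  obtain p where p: "shortest_path G p" "length p = Suc (?m + ?n)" "p ! 0 = x" "p ! ?m = y"
    "p ! (?m + ?n) = z"
    using shortest_path_through[OF verts(1) relpow_D relpow_D geo[symmetric]] verts by metis
  have pos: "0 < ?m" "0 < ?n" using D_pos verts ne by auto
  have "p \<noteq> []" using p(2) by auto
  then have ends: "hd p = x" "last p = z" using p by (auto simp: hd_conv_nth last_conv_nth)
  have "{x, y, z} \<subseteq> set p \<inter> ?W"
    using x y z p(2-) nth_mem[of 0 p] nth_mem[of ?m p] nth_mem[of "?m + ?n" p] by auto
  then have "3 \<le> card (set p \<inter> ?W)"
    using card_mono[of "set p \<inter> ?W" "{x, y, z}"] ne by simp
  moreover have "vwalk_length p \<le> 4" using p(2) geo short by simp
  ultimately have "(hd p \<in> V2 \<and> last p \<in> V2 \<and> vwalk_length p \<ge> 3) \<or>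
        mgp_form V1 V2 V3 p \<or> mgp_form V1 V2 V3 (rev p)"
    using partition p(1) ends x z unfolding mgp_partition_def by blast
  moreover have "\<not> mgp_form V1 V2 V3 (rev p)"
  proof
    assume "mgp_form V1 V2 V3 (rev p)"
    then have "hd (rev p) \<in> V2" by (auto simp: mgp_form_def)
    then show False using ends z disjoint by (auto simp: hd_rev)
  qed
  ultimately have form: "mgp_form V1 V2 V3 p" using ends z disjoint by blast
  then have "hd p \<in> V2" by (auto simp: mgp_form_def)
  then show "x \<in> V2" by (simp add: ends)
  show "y \<in> V2" if "D x z \<le> 3"
  proof -
    \<comment> \<open>Position 1 is the \<open>V2\<close> vertex of the form; position 2 of form (b) is unmarked.\<close>
    have "?m = 1 \<or> ?m = 2 \<and> ?n = 1" using pos geo that by linarith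
    then show ?thesis
      using form p(2) p(4) y geo that by (auto simp: mgp_form_def)
  qed
qed

text \<open>
  The truncations are those of a triple \<open>Copy x, Orig y, Orig z\<close>. Both summands are positive and
  the total is at most 3, so neither summand is truncated; then the triangle inequality shows that
  \<open>D x z\<close> is not truncated either.
\<close>

lemma middle_in_V2_if_min_additive:
  assumes "x \<in> V1 \<union> V2 \<union> V3" "y \<in> V1 \<union> V2 \<union> V3" "z \<in> V1 \<union> V3"
    and "x \<noteq> y" "y \<noteq> z" "x \<noteq> z"
    and "min (D x y) 3 + min (D y z) 4 = min (D x z) 3"
  shows "y \<in> V2"
proof -
  have verts: "x \<in> pverts G" "y \<in> pverts G" "z \<in> pverts G"
    using in_pverts assms by auto
  have "0 < D x y" "0 < D y z" using D_pos verts assms by auto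
  with assms(7) D_triangle[OF verts] have "D x y + D y z = D x z" "D x z \<le> 3"
    by (auto simp: min_def split: if_splits)
  with assms show ?thesis by (intro geodesic_to_V1_V3) auto
qed

abbreviation \<sigma> :: "'a mvertex set" where "\<sigma> \<equiv> mgp_sigma V1 V2 V3 V4"

lemma mem_sigma [simp]:
  "Orig x \<in> \<sigma> \<longleftrightarrow> x \<in> V1 \<union> V3" "Copy x \<in> \<sigma> \<longleftrightarrow> x \<in> V1 \<union> V2" "Root \<notin> \<sigma>"
  by (auto simp: mgp_sigma_def)

text \<open>
  Copies are at distance 2, so \<open>x\<close> and \<open>z\<close> would both be neighbours of \<open>y\<close>; then
  \<open>x \<in> V2\<close>, and the second condition puts \<open>z\<close> at distance 2 from \<open>y\<close>.
\<close>

lemma Orig_not_between_Copy_Copy: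
  assumes "x \<in> V1 \<union> V2" "y \<in> V1 \<union> V3" "z \<in> V1 \<union> V2" "x \<noteq> z"
  shows "DM (Copy x) (Orig y) + DM (Orig y) (Copy z) \<noteq> DM (Copy x) (Copy z)"
proof
  assume eq: "DM (Copy x) (Orig y) + DM (Orig y) (Copy z) = DM (Copy x) (Copy z)"
  have v: "x \<in> pverts G" "y \<in> pverts G" "z \<in> pverts G" using in_pverts assms by auto
  obtain t where t: "t \<in> pverts G" "y \<noteq> t" using v assms(4) by metis
  have pos: "x \<noteq> y \<Longrightarrow> 0 < D y x" "z \<noteq> y \<Longrightarrow> 0 < D y z" using D_pos v by auto
  have "y \<noteq> x" "y \<noteq> z" "D y x = 1" "D y z = 1"
    using eq pos DM_twins[OF v(2) t] DM_Orig_Copy[OF v(2,1)] DM_Orig_Copy[OF v(2,3)]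
      DM_Copy_Copy[OF v(1,3) assms(4)] DM_Copy_Orig[of x y]
    by (cases "y = x"; cases "y = z"; auto simp: min_def split: if_splits)+
  then have a: "(y, x) \<in> parcs G" "(y, z) \<in> parcs G" using adjacent_if_D_eq_1 v by blast+
  then have "x \<in> V2" using not_adjacent_V1 assms by blast
  from D_neighbour_of_V2(1)[OF assms(2) this a(1) assms(3)] \<open>D y z = 1\<close> \<open>y \<noteq> z\<close> assms(4)
  show False by auto
qed

text \<open>
  If the bases are distinct, the middle vertex of the geodesic would be in \<open>V2\<close>. If the copy is
  the twin of \<open>z\<close>, the first condition is violated; if it is the twin of \<open>y\<close>, the distances
  do not add up.
\<close>

lemma Orig_not_between_Copy_Orig:
  assumes "x \<in> V1 \<union> V2" "y \<in> V1 \<union> V3" "z \<in> V1 \<union> V3" "y \<noteq> z"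
  shows "DM (Copy x) (Orig y) + DM (Orig y) (Orig z) \<noteq> DM (Copy x) (Orig z)"
proof
  assume eq: "DM (Copy x) (Orig y) + DM (Orig y) (Orig z) = DM (Copy x) (Orig z)"
  have v: "x \<in> pverts G" "y \<in> pverts G" "z \<in> pverts G" using in_pverts assms by auto
  note com = DM_Copy_Orig and oo = DM_Orig_Orig[OF v(2,3)]
  have pos: "0 < D y z" using D_pos v assms by auto
  consider "x = z" | "x = y" | "x \<noteq> y" "x \<noteq> z" by blast
  then show False
  proof cases
    case 1
    with eq pos oo have "D y z = 1"
      using DM_twins[OF v(3,2)] DM_Orig_Copy[OF v(2,3)] assms(4)
      by (auto simp: com min_def split: if_splits)
    then have "(y, z) \<in> parcs G" using adjacent_if_D_eq_1 v by blast
    then have "z \<notin> V1" using not_adjacent_V1 assms by blast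
    with 1 assms disjoint show False by blast
  next
    case 2
    with eq pos oo show False
      using DM_twins[OF v(2,3) assms(4)] DM_Orig_Copy[OF v(3,2)] assms(4) D_commute[of z y]
      by (auto simp: com min_def split: if_splits)
  next
    case 3
    with eq oo have "min (D x y) 3 + min (D y z) 4 = min (D x z) 3"
      using DM_Orig_Copy[OF v(2,1)] DM_Orig_Copy[OF v(3,1)] D_commute[of z x] D_commute[of y x]
      by (auto simp: com)
    then have "y \<in> V2" using 3 assms by (intro middle_in_V2_if_min_additive[of x y z]) auto
    with assms(2) disjoint show False by blast
  qed
qed

text \<open>
  Total distance at most 4 leaves both summands untruncated, and the resulting geodesic of the
  graph has no end in \<open>V2\<close>.
\<close>

lemma Orig_not_between_Orig_Orig:
  assumes "x \<in> V1 \<union> V3" "y \<in> V1 \<union> V3" "z \<in> V1 \<union> V3" "x \<noteq> y" "y \<noteq> z" "x \<noteq> z"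
  shows "DM (Orig x) (Orig y) + DM (Orig y) (Orig z) \<noteq> DM (Orig x) (Orig z)"
proof
  assume eq: "DM (Orig x) (Orig y) + DM (Orig y) (Orig z) = DM (Orig x) (Orig z)"
  have v: "x \<in> pverts G" "y \<in> pverts G" "z \<in> pverts G" using in_pverts assms by auto
  have "0 < D x y" "0 < D y z" using D_pos v assms by auto
  with eq D_triangle[OF v] have "D x y + D y z = D x z" "D x z \<le> 4"
    by (auto simp: DM_Orig_Orig v min_def split: if_splits)
  then have "x \<in> V2" using assms by (intro geodesic_to_V1_V3(1)[of x y z]) auto
  with assms(1) disjoint show False by blast
qed

lemma Copy_not_between_Copy_Copy:
  assumes "x \<in> V1 \<union> V2" "y \<in> V1 \<union> V2" "z \<in> V1 \<union> V2" "x \<noteq> y" "y \<noteq> z" "x \<noteq> z"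
  shows "DM (Copy x) (Copy y) + DM (Copy y) (Copy z) \<noteq> DM (Copy x) (Copy z)"
proof -
  have "x \<in> pverts G" "y \<in> pverts G" "z \<in> pverts G" using in_pverts assms by auto
  with assms show ?thesis by (simp add: DM_Copy_Copy)
qed

text \<open>
  The first summand is 2 and the sum at most 3, so \<open>z\<close> is adjacent to \<open>y\<close> and at distance at
  least 3 from \<open>x\<close>. But then \<open>y \<in> V2\<close>, and the second condition gives \<open>D z x = 2\<close>.
\<close>

lemma Copy_not_between_Copy_Orig:
  assumes "x \<in> V1 \<union> V2" "y \<in> V1 \<union> V2" "z \<in> V1 \<union> V3" "x \<noteq> y"
  shows "DM (Copy x) (Copy y) + DM (Copy y) (Orig z) \<noteq> DM (Copy x) (Orig z)"
proof
  assume eq: "DM (Copy x) (Copy y) + DM (Copy y) (Orig z) = DM (Copy x) (Orig z)"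
  have v: "x \<in> pverts G" "y \<in> pverts G" "z \<in> pverts G" using in_pverts assms by auto
  obtain t where t: "t \<in> pverts G" "z \<noteq> t" using v assms(4) by metis
  have pos: "y \<noteq> z \<Longrightarrow> 0 < D z y" using D_pos v by auto
  have "y \<noteq> z" "x \<noteq> z" "D z y = 1" "3 \<le> D z x"
    using eq pos DM_twins[OF v(3) t] DM_Orig_Copy[OF v(3,1)] DM_Orig_Copy[OF v(3,2)]
      DM_Copy_Copy[OF v(1,2) assms(4)] DM_Copy_Orig[of x z] DM_Copy_Orig[of y z]
    by (cases "y = z"; cases "x = z"; auto simp: min_def split: if_splits)+
  then have a: "(z, y) \<in> parcs G" using adjacent_if_D_eq_1 v by blast
  then have "y \<in> V2" using not_adjacent_V1 assms by blast
  from D_neighbour_of_V2(1)[OF assms(3) this a assms(1)] \<open>3 \<le> D z x\<close> \<open>x \<noteq> z\<close> assms(4)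
  show False by auto
qed

text \<open>
  The truncation of \<open>D y z\<close> at 3 could make a triple \<open>Orig x, Copy y, Orig z\<close> additive although
  \<open>D x y + D y z \<noteq> D x z\<close>. The second condition prevents this by bounding \<open>D x z\<close> by 3.
\<close>

lemma not_between_if_adjacent:
  assumes "x \<in> V1 \<union> V3" "y \<in> V1 \<union> V2" "z \<in> V1 \<union> V3" "x \<noteq> y" "y \<noteq> z" "x \<noteq> z"
    and "D x y = 1"
  shows "D x y + min (D y z) 3 \<noteq> min (D x z) 4"
proof
  assume eq: "D x y + min (D y z) 3 = min (D x z) 4"
  have v: "x \<in> pverts G" "y \<in> pverts G" "z \<in> pverts G" using in_pverts assms by auto
  have a: "(x, y) \<in> parcs G" using adjacent_if_D_eq_1 v assms(7) by blast
  then have "y \<in> V2" using not_adjacent_V1 assms by blast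
  from D_neighbour_of_V2[OF assms(1) this a] assms have "D x z \<le> 3" by fastforce
  with eq assms(7) have "D x y + D y z = D x z" by (auto simp: min_def split: if_splits)
  then have "x \<in> V2" using assms \<open>D x z \<le> 3\<close> by (intro geodesic_to_V1_V3(1)[of x y z]) auto
  with assms(1) disjoint show False by blast
qed

text \<open>
  If \<open>y\<close> is adjacent to neither end, the two summands are at least 2 and hence equal to 2, so
  that the graph itself has a geodesic of length 4 through \<open>y\<close> without an end in \<open>V2\<close>. A twin
  of an end is already at distance 2 from it, too far for additivity.
\<close>

lemma Copy_not_between_Orig_Orig:
  assumes "x \<in> V1 \<union> V3" "y \<in> V1 \<union> V2" "z \<in> V1 \<union> V3" "x \<noteq> z"
  shows "DM (Orig x) (Copy y) + DM (Copy y) (Orig z) \<noteq> DM (Orig x) (Orig z)"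
proof
  assume eq: "DM (Orig x) (Copy y) + DM (Copy y) (Orig z) = DM (Orig x) (Orig z)"
  have v: "x \<in> pverts G" "y \<in> pverts G" "z \<in> pverts G" using in_pverts assms by auto
  note com = DM_Copy_Orig and oo = DM_Orig_Orig[OF v(1,3)]
  have pos: "0 < D x z" using D_pos v assms by auto
  consider "y = x" | "y = z" | "x \<noteq> y" "y \<noteq> z" by blast
  then show False
  proof cases
    case 1
    with eq pos oo show False
      using DM_twins[OF v(1,3) assms(4)] DM_Orig_Copy[OF v(3,1)] assms(4) D_commute[of z x]
      by (auto simp: com min_def split: if_splits)
  next
    case 2
    with eq pos oo show False
      using DM_twins[OF v(3,1)] DM_Orig_Copy[OF v(1,3) assms(4)] assms(4)
      by (auto simp: com min_def split: if_splits)
  next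
    case 3
    have p: "0 < D x y" "0 < D y z" using D_pos v 3 by auto
    have e: "min (D x y) 3 + min (D y z) 3 = min (D x z) 4"
      using eq oo DM_Orig_Copy[OF v(1,2)] DM_Orig_Copy[OF v(3,2)] 3 D_commute[of z y]
      by (auto simp: com)
    have "D x y \<noteq> 1"
      using not_between_if_adjacent[OF assms(1-3) 3 assms(4)] e by auto
    moreover have "D z y \<noteq> 1"
      using not_between_if_adjacent[of z y x] assms 3 e D_commute[of z y] D_commute[of y x]
        D_commute[of z x] by auto
    ultimately have "D x y = 2" "D y z = 2" "4 \<le> D x z"
      using e p D_commute[of z y] by (auto simp: min_def split: if_splits)
    with D_triangle[OF v] have "D x y + D y z = D x z" "D x z \<le> 4" by auto
    then have "x \<in> V2" using assms 3 by (intro geodesic_to_V1_V3(1)[of x y z]) auto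
    with assms(1) disjoint show False by blast
  qed
qed

lemma general_position_sigma: "general_position_set (mycielskian G) \<sigma>"
proof -
  interpret M: pair_graph "mycielskian G" by (rule pair_graph_mycielskian) unfold_locales
  show ?thesis
  proof (rule M.general_position_setI)
    show "\<sigma> \<subseteq> pverts (mycielskian G)"
      using in_pverts by (auto simp: mgp_sigma_def mycielskian_def)
  next
    fix a b c assume S: "a \<in> \<sigma>" "b \<in> \<sigma>" "c \<in> \<sigma>" and ne: "a \<noteq> b" "b \<noteq> c" "a \<noteq> c"
    have rev: "DM a b + DM b c \<noteq> DM a c" if "DM c b + DM b a \<noteq> DM c a"
      using that DM_commute[of a b] DM_commute[of b c] DM_commute[of a c] by simp
    show "DM a b + DM b c \<noteq> DM a c"
    proof (cases a; cases b; cases c)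
      fix x y z assume "a = Orig x" "b = Orig y" "c = Copy z"
      then show ?thesis using S ne by (intro rev) (simp add: Orig_not_between_Copy_Orig)
    next
      fix x y z assume "a = Orig x" "b = Copy y" "c = Copy z"
      then show ?thesis using S ne by (intro rev) (simp add: Copy_not_between_Copy_Orig)
    qed (use S ne in \<open>simp_all add: Orig_not_between_Copy_Copy Orig_not_between_Copy_Orig Orig_not_between_Orig_Orig Copy_not_between_Copy_Copy
        Copy_not_between_Copy_Orig Copy_not_between_Orig_Orig\<close>)
  qed
qed

end

theorem theorem8:
  fixes G :: "'a pair_pre_digraph" and V1 V2 V3 V4 :: "'a set"
  assumes "pair_graph G"
    and "Digraph_Component.connected (with_proj G)"
    and "mgp_partition G V1 V2 V3 V4"
  shows "general_position_set (mycielskian G) (mgp_sigma V1 V2 V3 V4)"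
proof -
  interpret pair_graph G by (rule assms(1))
  interpret mgp_partitioned_graph G V1 V2 V3 V4 by unfold_locales (rule assms)+
  show ?thesis by (rule general_position_sigma)
qed

end
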